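(* Let $A$ be a $C^*$-algebra, let $X$ be a semi-inner product $C^*$-module over $A$, and let $p,a\in A$, $e\in X$ be such that $\langle e,e\rangle$ is an idempotent element of $A$. Let $f,g\in D_p(A,X)$ and let $\alpha,\beta,\alpha',\beta',\mu,\lambda,\mu',\lambda'$ be complex numbers such that $$\left\|f(p)-\frac{\alpha+\beta}{2}e\right\|\le\frac12|\alpha-\beta|,\qquad \left\|Df(p)(a)-\frac{\alpha'+\beta'}{2}e\right\|\le\frac12|\alpha'-\beta'|,$$ $$\left\|g(p)-\frac{\lambda+\mu}{2}e\right\|\le\frac12|\lambda-\mu|,\qquad \left\|Dg(p)(a)-\frac{\mu'+\lambda'}{2}e\right\|\le\frac12|\mu'-\lambda'|.$$ Then $$\Big\|\langle Df(p)(a),Dg(p)(a)\rangle_1+\langle f(p),g(p)\rangle_1-D\big\langle f(\cdot),g(\cdot)\big\rangle_1(p)(a)\Big\|\le\frac12\big(|\alpha-\beta|+|\alpha'-\beta'|\big)\big(|\lambda-\mu|+|\lambda'-\mu'|\big),$$ where $\langle x,y\rangle_1=\langle x,y\rangle-\langle x,e\rangle\langle e,y\rangle$ for $x,y\in X$.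
   Context: A semi-inner product $C^*$-module over a $C^*$-algebra $A$ is a right $A$-module $X$ with a generalized semi-inner product, i.e. a map $\langle\cdot,\cdot\rangle:X\times X\to A$ such that (i) $\langle x,y+z\rangle=\langle x,y\rangle+\langle x,z\rangle$; (ii) $\langle x,ya\rangle=\langle x,y\rangle a$; (iii) $\langle x,y\rangle^*=\langle y,x\rangle$; (iv) $\langle x,x\rangle\ge 0$, for all $x,y,z\in X$, $a\in A$. The (semi)norm on $X$ is $\|x\|=\|\langle x,x\rangle\|^{1/2}$. A function $f:A\to X$ is Fréchet differentiable at $q\in A$ if there is a bounded linear map $u=Df(q):A\to X$ with $\lim_{h\to0}\|f(q+h)-f(q)-u(h)\|/\|h\|=0$. $D_p(A,X)$ denotes the set of all continuous functions $f:A\to X$ that are Fréchet differentiable on an open neighborhood $U$ of $p$. $D\langle f(\cdot),g(\cdot)\rangle_1(p)$ is the derivative at $p$ of the function $t\mapsto\langle f(t),g(t)\rangle_1$ from $A$ to $A$, where $A$ is regarded as a real normed space for this derivative; it is given by the product rule $D\langle f(\cdot),g(\cdot)\rangle_1(p)(a)=\langle Df(p)(a),g(p)\rangle_1+\langle f(p),Dg(p)(a)\rangle_1$. *)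

theory Defs
  imports "HOL-Analysis.Analysis"
begin

class complex_vector = real_vector +
  fixes scaleC :: "complex \<Rightarrow> 'a \<Rightarrow> 'a"  (infixr "*\<^sub>C" 75)
  assumes scaleC_add_right: "c *\<^sub>C (x + y) = c *\<^sub>C x + c *\<^sub>C y"
    and scaleC_add_left: "(c + d) *\<^sub>C x = c *\<^sub>C x + d *\<^sub>C x"
    and scaleC_scaleC: "c *\<^sub>C d *\<^sub>C x = (c * d) *\<^sub>C x"
    and scaleC_of_real: "complex_of_real r *\<^sub>C x = r *\<^sub>R x"

global_interpretation complex_vector: vector_space "scaleC :: complex \<Rightarrow> 'a \<Rightarrow> 'a::complex_vector"
  by unfold_locales
    (use scaleC_of_real[of 1] in \<open>auto simp: scaleC_add_right scaleC_add_left scaleC_scaleC\<close>)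

text \<open>A C*-algebra is not required to have a unit (nor to be nonzero).\<close>

class cstar_algebra = complex_vector + real_normed_algebra + banach +
  fixes star :: "'a \<Rightarrow> 'a"
  assumes mult_scaleC_left: "(c *\<^sub>C a) * b = c *\<^sub>C (a * b)"
    and mult_scaleC_right: "a * (c *\<^sub>C b) = c *\<^sub>C (a * b)"
    and norm_scaleC: "norm (c *\<^sub>C a) = cmod c * norm a"
    and star_star: "star (star a) = a"
    and star_add: "star (a + b) = star a + star b"
    and star_scaleC: "star (c *\<^sub>C a) = cnj c *\<^sub>C star a"
    and star_mult: "star (a * b) = star b * star a"
    and norm_star_mult: "norm (star a * a) = (norm a)\<^sup>2"

instantiation complex :: cstar_algebra
begin

definition scaleC_complex :: "complex \<Rightarrow> complex \<Rightarrow> complex" where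
  "scaleC_complex c x = c * x"

definition star_complex :: "complex \<Rightarrow> complex" where
  "star_complex x = cnj x"

instance
  by standard
    (auto simp: scaleC_complex_def star_complex_def algebra_simps scaleR_conv_of_real
      norm_mult power2_eq_square)

end

definition cstar_nonneg :: "'a::cstar_algebra \<Rightarrow> bool" where
  "cstar_nonneg a \<longleftrightarrow> (\<exists>b. a = star b * b)"

text \<open>Homogeneity of \<open>ip\<close> under complex scalars is not an axiom: it follows from \<open>ip_act\<close>
  and the compatibility of the two scalar multiplications.\<close>

locale semi_inner_product_module =
  fixes act :: "'x::complex_vector \<Rightarrow> 'a::cstar_algebra \<Rightarrow> 'x"
    and ip :: "'x \<Rightarrow> 'x \<Rightarrow> 'a"
  assumes act_add_left: "act (x + y) a = act x a + act y a"
    and act_add_right: "act x (a + b) = act x a + act x b"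
    and act_mult: "act x (a * b) = act (act x a) b"
    and act_scaleC_left: "act (c *\<^sub>C x) a = c *\<^sub>C act x a"
    and act_scaleC_right: "act x (c *\<^sub>C a) = c *\<^sub>C act x a"
    and ip_add: "ip x (y + z) = ip x y + ip x z"
    and ip_act: "ip x (act y a) = ip x y * a"
    and ip_star: "star (ip x y) = ip y x"
    and ip_nonneg: "cstar_nonneg (ip x x)"

lemma semi_inner_product_module_self:
  "semi_inner_product_module (*) (\<lambda>x y :: 'a::cstar_algebra. star x * y)"
  by unfold_locales
    (auto simp: algebra_simps mult_scaleC_left mult_scaleC_right star_mult star_star cstar_nonneg_def)

definition ip_norm :: "('x \<Rightarrow> 'x \<Rightarrow> 'a::real_normed_vector) \<Rightarrow> 'x \<Rightarrow> real" where
  "ip_norm ip x = sqrt (norm (ip x x))"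

text \<open>Since \<open>ip_norm ip\<close> is only a seminorm, \<open>'x\<close> is not an instance of
  \<^class>\<open>real_normed_vector\<close>, and continuity and derivatives of maps into \<open>'x\<close> are spelled out.
  A derivative is unique only up to vectors of seminorm zero, hence a relation.\<close>

definition ip_continuous ::
    "('x::complex_vector \<Rightarrow> 'x \<Rightarrow> 'a) \<Rightarrow> ('a::cstar_algebra \<Rightarrow> 'x) \<Rightarrow> bool" where
  "ip_continuous ip f \<longleftrightarrow> (\<forall>q. ((\<lambda>t. ip_norm ip (f t - f q)) \<longlongrightarrow> 0) (at q))"

definition ip_has_derivative ::
    "('x::complex_vector \<Rightarrow> 'x \<Rightarrow> 'a) \<Rightarrow> ('a::cstar_algebra \<Rightarrow> 'x) \<Rightarrow> ('a \<Rightarrow> 'x) \<Rightarrow> 'a \<Rightarrow> bool" where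
  "ip_has_derivative ip f u q \<longleftrightarrow>
     Vector_Spaces.linear (*\<^sub>C) (*\<^sub>C) u \<and>
     (\<exists>K. \<forall>h. ip_norm ip (u h) \<le> K * norm h) \<and>
     ((\<lambda>h. ip_norm ip (f (q + h) - f q - u h) / norm h) \<longlongrightarrow> 0) (at 0)"

definition differentiable_near ::
    "('x::complex_vector \<Rightarrow> 'x \<Rightarrow> 'a) \<Rightarrow> 'a \<Rightarrow> ('a::cstar_algebra \<Rightarrow> 'x) set" where
  "differentiable_near ip p =
     {f. ip_continuous ip f \<and>
         (\<exists>U. open U \<and> p \<in> U \<and> (\<forall>q\<in>U. \<exists>u. ip_has_derivative ip f u q))}"

definition ip1 :: "('x \<Rightarrow> 'x \<Rightarrow> 'a::ring) \<Rightarrow> 'x \<Rightarrow> 'x \<Rightarrow> 'x \<Rightarrow> 'a" where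
  "ip1 ip e x y = ip x y - ip x e * ip e y"

end

theory Submission
  imports Defs "HOL-Computational_Algebra.Formal_Power_Series"
begin

text \<open>
  The left-hand side is \<open>\<langle>Df - f, Dg - g\<rangle>\<^sub>1\<close>, and \<open>\<langle>\<cdot>, \<cdot>\<rangle>\<^sub>1\<close> annihilates multiples of \<open>e\<close> because
  \<open>e - e \<langle>e, e\<rangle>\<close> has seminorm zero. So the four vectors may be replaced by their distances to
  multiples of \<open>e\<close>, and the bound \<open>norm \<langle>x, y\<rangle>\<^sub>1 \<le> 2 (norm x) (norm y)\<close> suffices. It follows from the
  Cauchy-Schwarz inequality of the module, which also gives the product rule.

  Cauchy-Schwarz needs that elements \<open>b\<^sup>* b\<close> form a cone on which the norm is monotone. In the
  unitization, call a self-adjoint \<open>h\<close> positive if \<open>norm (t - h) \<le> t\<close> for some \<open>t \<ge> 0\<close>. This is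
  a cone by the triangle inequality, the binomial series gives positive square roots, and unitaries
  \<open>r + \<i> s\<close> built from square roots yield positivity of squares and monotonicity of the norm without
  any spectral theory. Finally every \<open>b\<^sup>* b\<close> is shown to be positive.
\<close>

section \<open>Consequences of the C*-identity\<close>

lemma scaleC_scaleR: "c *\<^sub>C r *\<^sub>R (x::'a::complex_vector) = r *\<^sub>R c *\<^sub>C x"
  by (simp add: scaleC_of_real [symmetric] scaleC_scaleC mult.commute)

lemma star_scaleR: "star (r *\<^sub>R (a::'a::cstar_algebra)) = r *\<^sub>R star a"
  by (simp add: scaleC_of_real [symmetric] star_scaleC)

lemma star_zero [simp]: "star (0::'a::cstar_algebra) = 0"
  using star_scaleR [of 0 "0::'a"] by simp

lemma star_minus: "star (- (a::'a::cstar_algebra)) = - star a"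
  using star_scaleR [of "-1" a] by simp

lemma star_diff: "star ((a::'a::cstar_algebra) - b) = star a - star b"
  using star_add [of a "- b"] by (simp add: star_minus)

text \<open>By the C*-identity and submultiplicativity, the square of \<open>norm b\<close> is at
  most \<open>norm (star b) * norm b\<close>. Cancelling \<open>norm b\<close> gives one inequality,
  and the same for \<open>star b\<close> the other.\<close>

lemma norm_star [simp]: "norm (star (a::'a::cstar_algebra)) = norm a"
proof -
  have le: "norm b \<le> norm (star b)" for b :: 'a
  proof (cases "b = 0")
    case False
    have "norm b * norm b \<le> norm (star b) * norm b"
      by (metis norm_star_mult norm_mult_ineq power2_eq_square)
    then show ?thesis using False by simp
  qed simp
  show ?thesis using le [of a] le [of "star a"] by (simp add: star_star)
qed

lemma bounded_linear_star: "bounded_linear (star :: 'a::cstar_algebra \<Rightarrow> 'a)"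
  by (intro bounded_linear_intro [where K = 1]) (auto simp: star_add star_scaleR)

lemma norm_mult_star: "norm (a * star a) = (norm (a::'a::cstar_algebra))\<^sup>2"
  using norm_star_mult [of "star a"] by (simp add: star_star)

section \<open>The unitization\<close>

datatype 'a unitization = Unitization (vec_part: 'a) (scal_part: complex)

lemma unitization_eq_iff: "u = v \<longleftrightarrow> vec_part u = vec_part v \<and> scal_part u = scal_part v"
  by (cases u; cases v) auto

text \<open>The adjoined-unit element \<open>a + c\<close> acting on the algebra, which is an ideal
  of the unitization. The operator norm of this action enters the norm below.\<close>

definition left_mult :: "'a::cstar_algebra unitization \<Rightarrow> 'a \<Rightarrow> 'a" where
  "left_mult u x = vec_part u * x + scal_part u *\<^sub>C x"

lemma bounded_linear_left_mult: "bounded_linear (left_mult u)"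
proof (rule bounded_linear_intro [where K = "norm (vec_part u) + cmod (scal_part u)"])
  fix x
  have "norm (left_mult u x) \<le> norm (vec_part u * x) + norm (scal_part u *\<^sub>C x)"
    unfolding left_mult_def by (rule norm_triangle_ineq)
  also have "\<dots> \<le> norm (vec_part u) * norm x + cmod (scal_part u) * norm x"
    by (simp add: norm_mult_ineq norm_scaleC)
  finally show "norm (left_mult u x) \<le> norm x * (norm (vec_part u) + cmod (scal_part u))"
    by (simp add: algebra_simps)
qed (simp_all add: left_mult_def algebra_simps scaleC_add_right scaleC_scaleR)

text \<open>Taking the maximum with the modulus of the scalar part keeps this a norm, with value 1
  at the unit, even if the algebra already has a unit or is zero.\<close>

instantiation unitization :: (cstar_algebra) "{complex_vector, real_normed_algebra}"
begin

definition zero_unitization :: "'a unitization" where "0 = Unitization 0 0"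

definition plus_unitization :: "'a unitization \<Rightarrow> 'a unitization \<Rightarrow> 'a unitization" where
  "u + v = Unitization (vec_part u + vec_part v) (scal_part u + scal_part v)"

definition uminus_unitization :: "'a unitization \<Rightarrow> 'a unitization" where
  "- u = Unitization (- vec_part u) (- scal_part u)"

definition minus_unitization :: "'a unitization \<Rightarrow> 'a unitization \<Rightarrow> 'a unitization" where
  "u - v = Unitization (vec_part u - vec_part v) (scal_part u - scal_part v)"

definition scaleR_unitization :: "real \<Rightarrow> 'a unitization \<Rightarrow> 'a unitization" where
  "r *\<^sub>R u = Unitization (r *\<^sub>R vec_part u) (r *\<^sub>R scal_part u)"

definition scaleC_unitization :: "complex \<Rightarrow> 'a unitization \<Rightarrow> 'a unitization" where
  "c *\<^sub>C u = Unitization (c *\<^sub>C vec_part u) (c * scal_part u)"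

definition times_unitization :: "'a unitization \<Rightarrow> 'a unitization \<Rightarrow> 'a unitization" where
  "u * v = Unitization (vec_part u * vec_part v + scal_part u *\<^sub>C vec_part v
             + scal_part v *\<^sub>C vec_part u) (scal_part u * scal_part v)"

definition norm_unitization :: "'a unitization \<Rightarrow> real" where
  "norm u = max (onorm (left_mult u)) (cmod (scal_part u))"

definition dist_unitization :: "'a unitization \<Rightarrow> 'a unitization \<Rightarrow> real" where
  "dist_unitization u v = norm (u - v)"

definition sgn_unitization :: "'a unitization \<Rightarrow> 'a unitization" where
  "sgn_unitization u = inverse (norm u) *\<^sub>R u"

definition uniformity_unitization :: "('a unitization \<times> 'a unitization) filter" where
  "uniformity_unitization = (INF e\<in>{0<..}. principal {(u, v). dist u v < e})"

definition open_unitization :: "'a unitization set \<Rightarrow> bool" where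
  "open_unitization S \<longleftrightarrow> (\<forall>u\<in>S. \<forall>\<^sub>F (u', v) in uniformity. u' = u \<longrightarrow> v \<in> S)"

lemmas unitization_simps = zero_unitization_def plus_unitization_def uminus_unitization_def
  minus_unitization_def scaleR_unitization_def scaleC_unitization_def times_unitization_def

lemma left_mult_times: "left_mult (u * v) = left_mult u \<circ> left_mult v"
  by (auto simp: fun_eq_iff left_mult_def unitization_simps algebra_simps scaleC_add_right
      mult_scaleC_left mult_scaleC_right scaleC_scaleC)

lemma norm_left_mult_le: "norm (left_mult u x) \<le> onorm (left_mult u) * norm x"
  by (rule onorm [OF bounded_linear_left_mult])

lemma onorm_left_mult_times:
  "onorm (left_mult (u * v)) \<le> onorm (left_mult u) * onorm (left_mult v)"
  unfolding left_mult_times by (intro onorm_compose bounded_linear_left_mult)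

text \<open>Test the operator on \<open>star a\<close>, where \<open>a\<close> is the vector part:
  \<open>norm (a * star a)\<close> is the square of \<open>norm a\<close>.\<close>

lemma norm_vec_part_le: "norm (vec_part u) \<le> onorm (left_mult u) + cmod (scal_part u)"
proof (cases "vec_part u = 0")
  case True
  then show ?thesis by (simp add: onorm_pos_le [OF bounded_linear_left_mult])
next
  case False
  let ?a = "vec_part u"
  have "norm ?a * norm ?a = norm (left_mult u (star ?a) - scal_part u *\<^sub>C star ?a)"
    by (simp add: left_mult_def norm_mult_star power2_eq_square)
  also have "\<dots> \<le> norm (left_mult u (star ?a)) + norm (scal_part u *\<^sub>C star ?a)"
    by (rule norm_triangle_ineq4)
  also have "\<dots> \<le> (onorm (left_mult u) + cmod (scal_part u)) * norm ?a"
    using norm_left_mult_le [of u "star ?a"] by (simp add: norm_scaleC algebra_simps)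
  finally show ?thesis using False by simp
qed

lemma norm_unitization_le: "norm u \<le> norm (vec_part u) + cmod (scal_part u)"
proof -
  have "norm (left_mult u x) \<le> (norm (vec_part u) + cmod (scal_part u)) * norm x" for x
    unfolding left_mult_def
    by (rule norm_triangle_le)
      (use norm_mult_ineq [of "vec_part u" x] in \<open>simp add: norm_scaleC algebra_simps\<close>)
  then show ?thesis unfolding norm_unitization_def by (simp add: onorm_bound)
qed

text \<open>With \<open>norm_unitization_le\<close>, this makes the norm equivalent to the sum of
  the norms of the two parts. Definiteness and completeness rest on it.\<close>

lemma norm_parts_le: "norm (vec_part u) \<le> 2 * norm u" "cmod (scal_part u) \<le> norm u"
  using norm_vec_part_le [of u] unfolding norm_unitization_def by auto

lemma norm_zero_unitization: "norm (0 :: 'a unitization) = 0"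
  using norm_unitization_le [of 0] norm_parts_le(2) [of 0] by (simp add: zero_unitization_def)

instance
proof
  fix u v w :: "'a unitization" and r s :: real and c d :: complex
  show "u + v + w = u + (v + w)" "u + v = v + u" "0 + u = u" "- u + u = 0" "u - v = u + - v"
    "r *\<^sub>R (u + v) = r *\<^sub>R u + r *\<^sub>R v" "(r + s) *\<^sub>R u = r *\<^sub>R u + s *\<^sub>R u"
    "r *\<^sub>R s *\<^sub>R u = (r * s) *\<^sub>R u" "1 *\<^sub>R u = u"
    "c *\<^sub>C (u + v) = c *\<^sub>C u + c *\<^sub>C v" "(c + d) *\<^sub>C u = c *\<^sub>C u + d *\<^sub>C u"
    "c *\<^sub>C d *\<^sub>C u = (c * d) *\<^sub>C u" "complex_of_real r *\<^sub>C u = r *\<^sub>R u"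
    by (simp_all add: unitization_simps algebra_simps scaleC_add_right scaleC_add_left
        scaleC_scaleC scaleC_of_real scaleR_conv_of_real)
  show "u * v * w = u * (v * w)" "(u + v) * w = u * w + v * w" "u * (v + w) = u * v + u * w"
    "r *\<^sub>R u * v = r *\<^sub>R (u * v)" "u * r *\<^sub>R v = r *\<^sub>R (u * v)"
    by (simp_all add: unitization_simps algebra_simps scaleC_add_right scaleC_add_left
        scaleC_scaleC mult_scaleC_left mult_scaleC_right scaleC_scaleR scaleC_of_real [symmetric] scaleC_complex_def)
  show "dist u v = norm (u - v)" by (rule dist_unitization_def)
  show "sgn u = inverse (norm u) *\<^sub>R u" by (rule sgn_unitization_def)
  show "uniformity = (INF e\<in>{0<..}. principal {(u, v :: 'a unitization). dist u v < e})"
    by (rule uniformity_unitization_def)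
  show "open S \<longleftrightarrow> (\<forall>u\<in>S. \<forall>\<^sub>F (u', v) in uniformity. u' = u \<longrightarrow> v \<in> S)"
    for S :: "'a unitization set"
    by (rule open_unitization_def)
  show "norm u = 0 \<longleftrightarrow> u = 0"
  proof
    assume "norm u = 0"
    then show "u = 0" using norm_parts_le [of u] by (simp add: unitization_eq_iff unitization_simps)
  qed (simp add: norm_zero_unitization)
  have eq: "left_mult (u + v) = (\<lambda>x. left_mult u x + left_mult v x)"
    by (auto simp: fun_eq_iff left_mult_def unitization_simps algebra_simps scaleC_add_left)
  have "onorm (left_mult (u + v)) \<le> onorm (left_mult u) + onorm (left_mult v)"
    unfolding eq by (intro onorm_triangle bounded_linear_left_mult)
  moreover have "cmod (scal_part (u + v)) \<le> cmod (scal_part u) + cmod (scal_part v)"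
    by (simp add: unitization_simps norm_triangle_ineq)
  ultimately show "norm (u + v) \<le> norm u + norm v"
    unfolding norm_unitization_def by linarith
  have eq: "left_mult (r *\<^sub>R u) = (\<lambda>x. r *\<^sub>R left_mult u x)"
    by (auto simp: fun_eq_iff left_mult_def unitization_simps scaleC_scaleC scaleC_complex_def
        scaleC_of_real [symmetric] mult_scaleC_left scaleC_add_right)
  show "norm (r *\<^sub>R u) = \<bar>r\<bar> * norm u"
    unfolding norm_unitization_def eq onorm_scaleR [OF bounded_linear_left_mult]
    by (simp add: unitization_simps max_mult_distrib_left)
  have n: "cmod (scal_part (u * v)) = cmod (scal_part u) * cmod (scal_part v)"
    by (simp add: unitization_simps norm_mult)
  have "onorm (left_mult u) * onorm (left_mult v) \<le> norm u * norm v"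
    "cmod (scal_part u) * cmod (scal_part v) \<le> norm u * norm v"
    unfolding norm_unitization_def
    by (intro mult_mono onorm_pos_le bounded_linear_left_mult; simp add: le_max_iff_disj)+
  then show "norm (u * v) \<le> norm u * norm v"
    using onorm_left_mult_times [of u v] n by (simp add: norm_unitization_def [of "u * v"])
qed

end

section \<open>Involution, C*-identity and completeness of the unitization\<close>

instantiation unitization :: (cstar_algebra) cstar_algebra
begin

definition star_unitization :: "'a unitization \<Rightarrow> 'a unitization" where
  "star u = Unitization (star (vec_part u)) (cnj (scal_part u))"

text \<open>For the algebra-valued inner product \<open>star x * y\<close>, the operators of
  \<open>u\<close> and \<open>star u\<close> are adjoint; this carries the C*-identity over to
  operator norms.\<close>

lemma star_left_mult: "star (left_mult u x) * y = star x * left_mult (star u) y"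
  by (simp add: left_mult_def star_add star_mult star_scaleC unitization_simps star_unitization_def algebra_simps
      mult_scaleC_left mult_scaleC_right)

text \<open>The C*-identity of the algebra and adjointness turn the square of
  \<open>norm (left_mult u x)\<close> into the norm of
  \<open>star x * left_mult (star u * u) x\<close>.\<close>

lemma onorm_left_mult_square: "(onorm (left_mult u))\<^sup>2 \<le> onorm (left_mult (star u * u))"
proof -
  let ?N = "onorm (left_mult (star u * u))"
  have N: "0 \<le> ?N" by (rule onorm_pos_le [OF bounded_linear_left_mult])
  have "norm (left_mult u x) \<le> sqrt ?N * norm x" for x
  proof (rule power2_le_imp_le)
    have "(norm (left_mult u x))\<^sup>2 = norm (star x * left_mult (star u * u) x)"
      by (simp add: norm_star_mult [symmetric] star_left_mult left_mult_times)
    also have "\<dots> \<le> norm x * norm (left_mult (star u * u) x)"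
      by (metis norm_mult_ineq norm_star)
    also have "\<dots> \<le> norm x * (?N * norm x)"
      by (intro mult_left_mono norm_left_mult_le) simp
    finally show "(norm (left_mult u x))\<^sup>2 \<le> (sqrt ?N * norm x)\<^sup>2"
      using N by (simp add: power_mult_distrib power2_eq_square algebra_simps)
  qed (use N in simp)
  then have "onorm (left_mult u) \<le> sqrt ?N"
    using N by (intro onorm_bound) auto
  then have "(onorm (left_mult u))\<^sup>2 \<le> (sqrt ?N)\<^sup>2"
    by (intro power_mono onorm_pos_le bounded_linear_left_mult)
  then show ?thesis using N by simp
qed

text \<open>The same cancellation as in \<open>norm_star\<close>, with vanishing operator norm
  treated apart.\<close>

lemma onorm_left_mult_star: "onorm (left_mult (star u)) = onorm (left_mult u)"
proof -
  have le: "onorm (left_mult v) \<le> onorm (left_mult (star v))" for v :: "'a unitization"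
  proof (cases "onorm (left_mult v) = 0")
    case True
    then show ?thesis by (simp add: onorm_pos_le [OF bounded_linear_left_mult])
  next
    case False
    have "(onorm (left_mult v))\<^sup>2 \<le> onorm (left_mult (star v)) * onorm (left_mult v)"
      using onorm_left_mult_square onorm_left_mult_times by (rule order_trans)
    moreover have "onorm (left_mult v) > 0"
      using False onorm_pos_le [OF bounded_linear_left_mult, of v] by linarith
    ultimately show ?thesis by (simp add: power2_eq_square)
  qed
  have "star (star u) = u" by (simp add: star_unitization_def star_star)
  then show ?thesis using le [of u] le [of "star u"] by simp
qed

instance
proof
  fix u v :: "'a unitization" and c :: complex
  show "(c *\<^sub>C u) * v = c *\<^sub>C (u * v)" "u * (c *\<^sub>C v) = c *\<^sub>C (u * v)"
    by (simp_all add: unitization_simps algebra_simps scaleC_add_right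
        scaleC_scaleC mult_scaleC_left mult_scaleC_right)
  show "star (star u) = u" "star (u + v) = star u + star v" "star (c *\<^sub>C u) = cnj c *\<^sub>C star u"
    "star (u * v) = star v * star u"
    by (simp_all add: unitization_simps star_unitization_def star_star star_add star_scaleC star_mult algebra_simps)
  show "norm (c *\<^sub>C u) = cmod c * norm u"
  proof (cases "c = 0")
    case True
    then show ?thesis
      using norm_zero_unitization by (simp add: unitization_simps)
  next
    case False
    have le: "onorm (left_mult (d *\<^sub>C v)) \<le> cmod d * onorm (left_mult v)" for d and v :: "'a unitization"
    proof (rule onorm_bound)
      show "0 \<le> cmod d * onorm (left_mult v)"
        by (simp add: onorm_pos_le [OF bounded_linear_left_mult])
    next
      fix x
      have "left_mult (d *\<^sub>C v) x = d *\<^sub>C left_mult v x"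
        by (simp add: left_mult_def unitization_simps scaleC_add_right scaleC_scaleC mult_scaleC_left)
      then show "norm (left_mult (d *\<^sub>C v) x) \<le> cmod d * onorm (left_mult v) * norm x"
        using norm_left_mult_le [of v x] by (simp add: norm_scaleC mult_left_mono mult.assoc)
    qed
    \<comment> \<open>The reverse inequality is the upper bound \<open>le\<close> for the scalar
      \<open>inverse c\<close> and the element \<open>c *\<^sub>C u\<close>.\<close>
    have "inverse c *\<^sub>C c *\<^sub>C u = u"
      using False by (simp add: unitization_simps scaleC_scaleC unitization_eq_iff)
    then have "onorm (left_mult u) \<le> inverse (cmod c) * onorm (left_mult (c *\<^sub>C u))"
      using le [of "inverse c" "c *\<^sub>C u"] by (simp add: norm_inverse)
    then have "cmod c * onorm (left_mult u) \<le> onorm (left_mult (c *\<^sub>C u))"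
      using False by (simp add: field_simps)
    then have "onorm (left_mult (c *\<^sub>C u)) = cmod c * onorm (left_mult u)"
      using le [of c u] by simp
    then show ?thesis
      unfolding norm_unitization_def
      by (simp add: max_mult_distrib_left) (simp add: unitization_simps norm_mult)
  qed
  have "onorm (left_mult (star u * u)) = (onorm (left_mult u))\<^sup>2"
    using onorm_left_mult_square [of u] onorm_left_mult_times [of "star u" u]
    by (simp add: onorm_left_mult_star power2_eq_square)
  moreover have "cmod (scal_part (star u * u)) = (cmod (scal_part u))\<^sup>2"
    by (simp add: unitization_simps star_unitization_def norm_mult power2_eq_square)
  moreover have "max (x\<^sup>2) (y\<^sup>2) = (max x y)\<^sup>2" if "0 \<le> x" "0 \<le> y" for x y :: real
    using that by (auto simp: max_def power_mono antisym)
  ultimately show "norm (star u * u) = (norm u)\<^sup>2"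
    unfolding norm_unitization_def by (simp add: onorm_pos_le [OF bounded_linear_left_mult])
next
  fix X :: "nat \<Rightarrow> 'a unitization"
  assume X: "Cauchy X"
  have d: "dist u v = norm (u - v)" for u v :: "'a unitization" by (rule dist_unitization_def)
  \<comment> \<open>By the equivalence of norms, both parts are Cauchy, and the pair of their limits
    is the limit of \<open>X\<close>.\<close>
  have "Cauchy (\<lambda>n. vec_part (X n))"
  proof (rule metric_CauchyI)
    fix e :: real assume "0 < e"
    then obtain M where "\<forall>m\<ge>M. \<forall>n\<ge>M. dist (X m) (X n) < e / 2"
      using X metric_CauchyD half_gt_zero by blast
    moreover have "dist (vec_part (X m)) (vec_part (X n)) \<le> 2 * dist (X m) (X n)" for m n
      using norm_parts_le(1) [of "X m - X n"]
      by (simp add: dist_norm dist_unitization_def) (simp add: unitization_simps)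
    ultimately show "\<exists>M. \<forall>m\<ge>M. \<forall>n\<ge>M. dist (vec_part (X m)) (vec_part (X n)) < e"
      by (metis less_divide_eq_numeral1(1) mult.commute order_le_less_trans)
  qed
  moreover have "Cauchy (\<lambda>n. scal_part (X n))"
  proof (rule metric_CauchyI)
    fix e :: real assume "0 < e"
    then obtain M where "\<forall>m\<ge>M. \<forall>n\<ge>M. dist (X m) (X n) < e"
      using X metric_CauchyD by blast
    moreover have "dist (scal_part (X m)) (scal_part (X n)) \<le> dist (X m) (X n)" for m n
      using norm_parts_le(2) [of "X m - X n"]
      by (simp add: dist_norm dist_unitization_def) (simp add: unitization_simps)
    ultimately show "\<exists>M. \<forall>m\<ge>M. \<forall>n\<ge>M. dist (scal_part (X m)) (scal_part (X n)) < e"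
      by (metis order_le_less_trans)
  qed
  ultimately obtain a c where a: "(\<lambda>n. vec_part (X n)) \<longlonglongrightarrow> a" and c: "(\<lambda>n. scal_part (X n)) \<longlonglongrightarrow> c"
    by (meson Cauchy_convergent convergent_def)
  have "(\<lambda>n. norm (vec_part (X n) - a) + cmod (scal_part (X n) - c)) \<longlonglongrightarrow> 0"
    using tendsto_add [OF tendsto_norm_zero [OF LIM_zero [OF a]] tendsto_norm_zero [OF LIM_zero [OF c]]]
    by simp
  then have "(\<lambda>n. dist (X n) (Unitization a c)) \<longlonglongrightarrow> 0"
  proof (rule tendsto_sandwich [OF _ _ tendsto_const, rotated 2])
    show "\<forall>\<^sub>F n in sequentially. dist (X n) (Unitization a c)
        \<le> norm (vec_part (X n) - a) + cmod (scal_part (X n) - c)"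
      using norm_unitization_le [of "X _ - Unitization a c"]
      by (simp add: dist_unitization_def) (simp add: unitization_simps)
  qed (simp add: dist_unitization_def)
  then show "convergent X"
    unfolding convergent_def using tendsto_dist_iff by blast
qed

end

instantiation unitization :: (cstar_algebra) real_normed_algebra_1
begin

definition one_unitization :: "'a unitization" where "1 = Unitization 0 1"

instance
proof
  fix u :: "'a unitization"
  show "(0::'a unitization) \<noteq> 1"
    by (simp add: one_unitization_def zero_unitization_def)
  show "1 * u = u" "u * 1 = u"
    by (simp_all add: one_unitization_def times_unitization_def unitization_eq_iff)
  have "cmod (scal_part (1::'a unitization)) = 1" "norm (vec_part (1::'a unitization)) = 0"
    by (simp_all add: one_unitization_def)
  then show "norm (1::'a unitization) = 1"
    using norm_unitization_le [of "1::'a unitization"] norm_parts_le(2) [of "1::'a unitization"]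
    by simp
qed

end

definition embed :: "'a::cstar_algebra \<Rightarrow> 'a unitization" where
  "embed a = Unitization a 0"

lemma embed_simps:
  "embed (a + b) = embed a + embed b" "embed (a - b) = embed a - embed b"
  "embed (a * b) = embed a * embed b" "embed (star a) = star (embed a)"
  "embed (r *\<^sub>R a) = r *\<^sub>R embed a"
  by (simp_all add: embed_def unitization_simps star_unitization_def)

text \<open>With scalar part \<open>0\<close>, both comparisons with the norm of the vector part are
  free of loss.\<close>

lemma norm_embed: "norm (embed a) = norm a"
proof (rule antisym)
  show "norm (embed a) \<le> norm a"
    using norm_unitization_le [of "embed a"] by (simp add: embed_def)
  show "norm a \<le> norm (embed a)"
    using norm_vec_part_le [of "embed a"] by (simp add: embed_def norm_unitization_def)
qed

section \<open>Positivity in unital algebras\<close>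

text \<open>The coefficients of the power series of \<open>\<lambda>z. sqrt (1 - z)\<close>.\<close>

definition sqrt_coeff :: "nat \<Rightarrow> real" where
  "sqrt_coeff n = (1 / 2 gchoose n) * (- 1) ^ n"

lemma sqrt_coeff_0 [simp]: "sqrt_coeff 0 = 1"
  by (simp add: sqrt_coeff_def)

text \<open>In Pochhammer form the signs of the coefficients and of their partial sums become
  visible.\<close>

lemma gbinomial_alternating: "((x::real) gchoose n) * (- 1) ^ n = pochhammer (- x) n / fact n"
  by (simp add: gbinomial_pochhammer power_mult_distrib [symmetric])

text \<open>Only the first factor \<open>- (1 / 2)\<close> of the rising factorial is
  negative.\<close>

lemma sqrt_coeff_Suc_nonpos: "sqrt_coeff (Suc n) \<le> 0"
proof -
  have "pochhammer (- (1 / 2)) (Suc n) = - (1 / 2) * pochhammer (1 / 2 :: real) n"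
    by (simp add: pochhammer_rec)
  moreover have "pochhammer (1 / 2 :: real) n \<ge> 0"
    by (intro pochhammer_nonneg) simp
  ultimately show ?thesis
    unfolding sqrt_coeff_def gbinomial_alternating by (simp add: divide_nonpos_pos)
qed

text \<open>The partial sums are the coefficients of \<open>sqrt (1 - z) / (1 - z)\<close>, that is,
  of \<open>1 / sqrt (1 - z)\<close>.\<close>

lemma sum_sqrt_coeff_nonneg: "0 \<le> (\<Sum>k\<le>n. sqrt_coeff k)"
proof -
  have "(\<Sum>k\<le>n. sqrt_coeff k) = (- (1 / 2) gchoose n) * (- 1) ^ n"
    unfolding sqrt_coeff_def gbinomial_sum_lower_neg by simp
  also have "\<dots> = pochhammer (1 / 2) n / fact n"
    unfolding gbinomial_alternating by simp
  finally show ?thesis by (simp add: pochhammer_nonneg)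
qed

text \<open>All coefficients after the constant \<open>1\<close> are nonpositive, so the sum of
  their absolute values is \<open>1\<close> minus a partial sum.\<close>

lemma sum_abs_sqrt_coeff_le: "(\<Sum>k<n. \<bar>sqrt_coeff (Suc k)\<bar>) \<le> 1"
proof -
  have "(\<Sum>k<n. \<bar>sqrt_coeff (Suc k)\<bar>) = - (\<Sum>k<n. sqrt_coeff (Suc k))"
    by (simp add: sum_negf [symmetric] sqrt_coeff_Suc_nonpos)
  also have "\<dots> = 1 - (\<Sum>k\<le>n. sqrt_coeff k)"
    by (simp add: sum.atMost_shift)
  finally show ?thesis using sum_sqrt_coeff_nonneg [of n] by simp
qed

lemma summable_abs_sqrt_coeff: "summable (\<lambda>n. \<bar>sqrt_coeff (Suc n)\<bar>)"
  using sum_abs_sqrt_coeff_le [of "Suc _"]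
  by (intro bounded_imp_summable [where B = 1]) (simp_all only: lessThan_Suc_atMost abs_ge_zero)

text \<open>Vandermonde's identity for \<open>1 / 2 + 1 / 2 = 1\<close>: the series squares formally
  to \<open>1 - z\<close>.\<close>

lemma sqrt_coeff_convolution:
  "(\<Sum>i\<le>n. sqrt_coeff i * sqrt_coeff (n - i)) = (if n = 0 then 1 else if n = 1 then - 1 else 0)"
proof -
  have "(\<Sum>i\<le>n. sqrt_coeff i * sqrt_coeff (n - i))
      = (\<Sum>i\<le>n. (1 / 2 gchoose i) * (1 / 2 gchoose (n - i)) * (- 1) ^ n)"
    by (intro sum.cong refl) (simp add: sqrt_coeff_def power_add [symmetric] algebra_simps)
  also have "\<dots> = (1 gchoose n) * (- 1) ^ n"
    using gbinomial_Vandermonde [of "1 / 2 :: real" "1 / 2" n]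
    by (simp add: sum_distrib_right [symmetric] atMost_atLeast0)
  also have "(1 gchoose n :: real) = of_nat (1 choose n)"
    by (simp add: binomial_gbinomial)
  finally show ?thesis by (cases n) (auto simp: binomial_eq_0)
qed

lemma star_one [simp]: "star (1::'a::{cstar_algebra,real_normed_algebra_1}) = 1"
  by (metis mult_1 mult_1_right star_mult star_star)

text \<open>Absolute summability of the coefficients makes the binomial series converge even when
  \<open>norm z = 1\<close>. Self-adjointness and commutation pass through the sum termwise, and the
  Cauchy product gives the square. The bound on \<open>1 - s\<close> will express that
  \<open>s\<close> is positive.\<close>

lemma sqrt_of_contraction:
  fixes z :: "'a::{cstar_algebra,real_normed_algebra_1}"
  assumes z: "norm z \<le> 1" "star z = z"
  obtains s where "star s = s" "s * s = 1 - z" "norm (1 - s) \<le> 1"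
    "\<And>x. x * z = z * x \<Longrightarrow> x * s = s * x"
proof
  define t where "t = (\<lambda>n. sqrt_coeff n *\<^sub>R z ^ n)"
  define s where "s = suminf t"
  have le: "norm (t n) \<le> \<bar>sqrt_coeff n\<bar>" for n
    using power_mono [of "norm z" 1 n] norm_power_ineq [of z n] z
    by (simp add: t_def mult_left_le)
  have summ_Suc: "summable (\<lambda>n. norm (t (Suc n)))"
    by (rule summable_comparison_test' [OF summable_abs_sqrt_coeff]) (use le in simp)
  then have summ: "summable (\<lambda>n. norm (t n))"
    by (subst (asm) summable_Suc_iff)
  then have t: "summable t" by (rule summable_norm_cancel)
  have star_pow: "star (z ^ n) = z ^ n" for n
  proof (induction n)
    case 0
    show ?case by simp
  next
    case (Suc n)
    then show ?case using z by (simp add: star_mult power_commutes)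
  qed
  show "star s = s"
    unfolding s_def bounded_linear.suminf [OF bounded_linear_star t]
    by (simp add: t_def star_scaleR star_pow)
  show "x * s = s * x" if "x * z = z * x" for x
  proof -
    have "x * z ^ n = z ^ n * x" for n
    proof (induction n)
      case (Suc n)
      have "x * z ^ Suc n = (x * z) * z ^ n" by (simp add: mult.assoc)
      also have "\<dots> = z * (x * z ^ n)" by (simp add: that mult.assoc)
      finally show ?case by (simp add: Suc.IH mult.assoc)
    qed simp
    then show ?thesis
      unfolding s_def suminf_mult [OF t, symmetric] suminf_mult2 [OF t] by (simp add: t_def)
  qed
  have "(\<lambda>n. \<Sum>i\<le>n. t i * t (n - i)) sums (s * s)"
    unfolding s_def by (rule Cauchy_product_sums [OF summ summ])
  moreover have "(\<Sum>i\<le>n. t i * t (n - i)) = (if n = 0 then 1 else if n = 1 then - z else 0)" for n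
  proof -
    have "(\<Sum>i\<le>n. t i * t (n - i)) = (\<Sum>i\<le>n. (sqrt_coeff i * sqrt_coeff (n - i)) *\<^sub>R z ^ n)"
      by (intro sum.cong refl) (simp add: t_def power_add [symmetric])
    then show ?thesis
      by (simp add: scaleR_left.sum [symmetric] sqrt_coeff_convolution)
  qed
  moreover have "(\<lambda>n. if n = 0 then 1 else if n = 1 then - z else 0) sums (1 - z)"
    using sums_finite [of "{0, 1}" "\<lambda>n. if n = 0 then 1 else if n = 1 then - z else 0"] by simp
  ultimately show "s * s = 1 - z"
    by (simp add: sums_unique2)
  have "s = (\<Sum>n. t (Suc n)) + t 0"
    unfolding s_def using suminf_split_head [OF t] by simp
  then have "norm (1 - s) = norm (\<Sum>n. t (Suc n))"
    by (simp add: t_def norm_minus_commute)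
  also have "\<dots> \<le> (\<Sum>n. norm (t (Suc n)))"
    by (intro summable_norm summ_Suc)
  also have "\<dots> \<le> (\<Sum>n. \<bar>sqrt_coeff (Suc n)\<bar>)"
    by (intro suminf_le le summable_abs_sqrt_coeff summ_Suc)
  also have "\<dots> \<le> 1"
    by (intro suminf_le_const summable_abs_sqrt_coeff sum_abs_sqrt_coeff_le)
  finally show "norm (1 - s) \<le> 1" .
qed

text \<open>For self-adjoint \<open>h\<close> the norm condition means that the spectrum of
  \<open>h\<close> lies in the interval from \<open>0\<close> to \<open>2 * t\<close>, so this is
  the usual positivity.\<close>

definition pos_elem :: "'a::{cstar_algebra,real_normed_algebra_1} \<Rightarrow> bool" where
  "pos_elem h \<longleftrightarrow> star h = h \<and> (\<exists>t\<ge>0. norm (t *\<^sub>R 1 - h) \<le> t)"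

lemma positive_star: "pos_elem h \<Longrightarrow> star h = h"
  by (simp add: pos_elem_def)

lemma positive_add:
  assumes "pos_elem h" "pos_elem k"
  shows "pos_elem (h + k)"
proof -
  obtain s t where st: "s \<ge> 0" "t \<ge> 0" "norm (s *\<^sub>R 1 - h) \<le> s" "norm (t *\<^sub>R 1 - k) \<le> t"
    using assms unfolding pos_elem_def by blast
  have "(s + t) *\<^sub>R 1 - (h + k) = (s *\<^sub>R 1 - h) + (t *\<^sub>R 1 - k)"
    by (simp add: algebra_simps)
  then have "norm ((s + t) *\<^sub>R 1 - (h + k)) \<le> s + t"
    using norm_triangle_mono [OF st(3,4)] by (simp only:)
  then show ?thesis using assms st unfolding pos_elem_def star_add by (metis add_nonneg_nonneg)
qed

lemma positive_scaleR:
  assumes "pos_elem h" "0 \<le> r"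
  shows "pos_elem (r *\<^sub>R h)"
proof -
  obtain t where t: "t \<ge> 0" "norm (t *\<^sub>R 1 - h) \<le> t"
    using assms unfolding pos_elem_def by blast
  have "norm ((r * t) *\<^sub>R 1 - r *\<^sub>R h) = r * norm (t *\<^sub>R 1 - h)"
    using assms(2) norm_scaleR [of r "t *\<^sub>R 1 - h"] by (simp add: algebra_simps)
  also have "\<dots> \<le> r * t" using t assms(2) by (simp add: mult_left_mono)
  finally show ?thesis using assms t unfolding pos_elem_def star_scaleR by (metis mult_nonneg_nonneg)
qed

text \<open>Dividing by \<open>t\<close> turns \<open>h\<close> into \<open>1 - z\<close> with
  \<open>z\<close> a self-adjoint contraction. The commutation clause lets roots of commuting
  elements be multiplied freely.\<close>

lemma positive_sqrt:
  assumes "pos_elem h"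
  obtains s where "pos_elem s" "s * s = h" "\<And>x. x * h = h * x \<Longrightarrow> x * s = s * x"
proof -
  obtain t where t: "t \<ge> 0" "norm (t *\<^sub>R 1 - h) \<le> t"
    using assms unfolding pos_elem_def by blast
  show ?thesis
  proof (cases "t = 0")
    case True
    then have "h = 0" using t by simp
    moreover from this have "pos_elem h" using assms by simp
    ultimately show ?thesis using that [of 0] by simp
  next
    case False
    with t have t0: "t > 0" by simp
    define z where "z = 1 - inverse t *\<^sub>R h"
    have "norm z = inverse t * norm (t *\<^sub>R 1 - h)"
      using norm_scaleR [of "inverse t" "t *\<^sub>R 1 - h"] t0 by (simp add: z_def scaleR_diff_right)
    then have "norm z \<le> 1" using mult_left_mono [OF t(2), of "inverse t"] t0 by simp
    moreover have "star z = z"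
      using assms by (simp add: z_def star_diff star_scaleR pos_elem_def)
    ultimately obtain s where s: "star s = s" "s * s = 1 - z" "norm (1 - s) \<le> 1"
      and comm: "\<And>x. x * z = z * x \<Longrightarrow> x * s = s * x"
      using sqrt_of_contraction by metis
    have "pos_elem s" unfolding pos_elem_def using s by (intro conjI exI [of _ 1]) auto
    then have "pos_elem (sqrt t *\<^sub>R s)" using t by (intro positive_scaleR) auto
    moreover have "(sqrt t *\<^sub>R s) * (sqrt t *\<^sub>R s) = h"
      using t0 s by (simp add: z_def mult.assoc [symmetric])
    moreover have "x * (sqrt t *\<^sub>R s) = (sqrt t *\<^sub>R s) * x" if "x * h = h * x" for x
      using comm [of x] that by (simp add: z_def algebra_simps)
    ultimately show ?thesis by (rule that)
  qed
qed

section \<open>Squares, order and norm\<close>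

lemma norm_self_adjoint_square:
  "star s = s \<Longrightarrow> norm (s * s) = (norm (s::'a::cstar_algebra))\<^sup>2"
  by (metis norm_star_mult)

text \<open>With \<open>c = sqrt (1 - s\<^sup>2)\<close>, the element \<open>s + \<i> c\<close> is unitary and the real part of its square
  is \<open>2 s\<^sup>2 - 1\<close>.\<close>

lemma norm_one_minus_square_le:
  fixes s :: "'a::{cstar_algebra,real_normed_algebra_1}"
  assumes s: "star s = s" "norm s \<le> 1"
  shows "norm (1 - 2 *\<^sub>R (s * s)) \<le> 1"
proof -
  have "norm (s * s) \<le> 1"
    using s by (simp add: norm_self_adjoint_square power_le_one)
  moreover have "star (s * s) = s * s" by (simp add: star_mult s)
  ultimately obtain c where c: "star c = c" "c * c = 1 - s * s"
    "\<And>x. x * (s * s) = s * s * x \<Longrightarrow> x * c = c * x"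
    using sqrt_of_contraction by metis
  have sc: "s * c = c * s" by (rule c) (simp add: mult.assoc)
  define U where "U = s + \<i> *\<^sub>C c"
  have sU: "star U = s - \<i> *\<^sub>C c"
    using complex_vector.scale_minus_left [of "\<i>" c] by (simp add: U_def star_add star_scaleC s c)
  have ii: "\<i> *\<^sub>C \<i> *\<^sub>C x = - x" for x :: 'a
    using complex_vector.scale_minus_left [of 1 x] by (simp add: scaleC_scaleC)
  have "star U * U = s * s + c * c"
    unfolding sU by (simp add: U_def algebra_simps mult_scaleC_left mult_scaleC_right ii sc)
  then have "(norm U)\<^sup>2 = 1" by (simp add: norm_star_mult [symmetric] c)
  then have U: "norm U = 1" using norm_ge_zero [of U] by (auto simp: power2_eq_1_iff)
  have "U * U + star U * star U = 2 *\<^sub>R (s * s - c * c)"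
    unfolding sU
    by (simp add: U_def algebra_simps mult_scaleC_left mult_scaleC_right ii sc scaleR_2)
  also have "\<dots> = - (2 *\<^sub>R (1 - 2 *\<^sub>R (s * s)))"
    by (simp add: c algebra_simps scaleR_2)
  finally have "2 * norm (1 - 2 *\<^sub>R (s * s)) = norm (U * U + star U * star U)"
    by (metis abs_numeral norm_minus_cancel norm_scaleR)
  also have "\<dots> \<le> norm (U * U) + norm (star U * star U)" by (rule norm_triangle_ineq)
  also have "\<dots> \<le> 1 + 1"
    using norm_mult_ineq [of U U] norm_mult_ineq [of "star U" "star U"] U by simp
  finally show ?thesis by simp
qed

text \<open>Rescale \<open>s\<close> to norm 1. The radius, half the norm of the square, is what
  makes the reflection in \<open>positive_norm_minus\<close> and the estimate in
  \<open>star_mult_negative_imp_zero\<close> work.\<close>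

lemma norm_half_minus_square_le:
  fixes s :: "'a::{cstar_algebra,real_normed_algebra_1}"
  assumes s: "star s = s"
  shows "norm ((norm (s * s) / 2) *\<^sub>R 1 - s * s) \<le> norm (s * s) / 2"
proof (cases "s = 0")
  case False
  let ?n = "norm s"
  have n: "?n > 0" using False by simp
  let ?u = "1 - 2 *\<^sub>R ((inverse ?n *\<^sub>R s) * (inverse ?n *\<^sub>R s))"
  have u: "norm ?u \<le> 1"
    by (rule norm_one_minus_square_le) (use n s in \<open>simp_all add: star_scaleR\<close>)
  have "(?n\<^sup>2 / 2) *\<^sub>R 1 - s * s = (?n\<^sup>2 / 2) *\<^sub>R ?u"
    using n by (simp add: scaleR_diff_right power2_eq_square field_simps)
  then have "norm ((?n\<^sup>2 / 2) *\<^sub>R 1 - s * s) = ?n\<^sup>2 / 2 * norm ?u"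
    by (simp only: norm_scaleR) simp
  also have "\<dots> \<le> ?n\<^sup>2 / 2" using u by (simp add: mult_left_le)
  finally show ?thesis using s by (simp add: norm_self_adjoint_square)
qed simp

lemma positive_square:
  fixes s :: "'a::{cstar_algebra,real_normed_algebra_1}"
  assumes "star s = s"
  shows "pos_elem (s * s)"
  unfolding pos_elem_def
  using norm_half_minus_square_le [OF assms] assms
  by (intro conjI exI [of _ "norm (s * s) / 2"]) (auto simp: star_mult)

text \<open>As \<open>h\<close> is a square, it lies in the ball of radius \<open>norm h / 2\<close>
  about \<open>norm h / 2\<close>, and this ball is invariant under subtraction from
  \<open>norm h\<close>.\<close>

lemma positive_norm_minus:
  fixes h :: "'a::{cstar_algebra,real_normed_algebra_1}"
  assumes "pos_elem h"
  shows "pos_elem (norm h *\<^sub>R 1 - h)"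
proof -
  obtain s where s: "pos_elem s" "s * s = h" by (rule positive_sqrt [OF assms])
  have "norm ((norm h / 2) *\<^sub>R 1 - h) \<le> norm h / 2"
    using norm_half_minus_square_le [OF positive_star [OF s(1)]] s by simp
  moreover have "norm ((norm h / 2) *\<^sub>R 1 - (norm h *\<^sub>R 1 - h)) = norm ((norm h / 2) *\<^sub>R 1 - h)"
  proof -
    have "norm h *\<^sub>R 1 = (norm h / 2) *\<^sub>R (1::'a) + (norm h / 2) *\<^sub>R 1"
      by (simp add: scaleR_left.add [symmetric])
    then have "(norm h / 2) *\<^sub>R 1 - (norm h *\<^sub>R 1 - h) = - ((norm h / 2) *\<^sub>R 1 - h)"
      by (simp only:) (simp add: algebra_simps)
    then show ?thesis by (metis norm_minus_cancel)
  qed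
  ultimately show ?thesis
    unfolding pos_elem_def using positive_star [OF assms]
    by (intro conjI exI [of _ "norm h / 2"]) (auto simp: star_diff star_scaleR)
qed

text \<open>With \<open>r = sqrt h\<close> and \<open>s = sqrt (m - h)\<close>, the element \<open>U = r + \<i> s\<close> satisfies
  \<open>U\<^sup>* U = m\<close>, and \<open>r\<close> is its real part.\<close>

lemma norm_le_of_positive:
  fixes h :: "'a::{cstar_algebra,real_normed_algebra_1}"
  assumes h: "pos_elem h" and mh: "pos_elem (m *\<^sub>R 1 - h)"
  shows "norm h \<le> \<bar>m\<bar>"
proof -
  obtain r where r: "pos_elem r" "r * r = h" "\<And>x. x * h = h * x \<Longrightarrow> x * r = r * x"
    using positive_sqrt [OF h] by metis
  obtain s where s: "pos_elem s" "s * s = m *\<^sub>R 1 - h"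
    "\<And>x. x * (m *\<^sub>R 1 - h) = (m *\<^sub>R 1 - h) * x \<Longrightarrow> x * s = s * x"
    using positive_sqrt [OF mh] by metis
  have rs: "r * s = s * r"
    by (rule s) (simp add: algebra_simps r(2) [symmetric])
  define U where "U = r + \<i> *\<^sub>C s"
  have star: "star r = r" "star s = s" by (rule positive_star [OF r(1)], rule positive_star [OF s(1)])
  have sU: "star U = r - \<i> *\<^sub>C s"
    using complex_vector.scale_minus_left [of "\<i>" s] by (simp add: U_def star_add star_scaleC star)
  have ii: "\<i> *\<^sub>C \<i> *\<^sub>C x = - x" for x :: 'a
    using complex_vector.scale_minus_left [of 1 x] by (simp add: scaleC_scaleC)
  have "star U * U = r * r + s * s"
    unfolding sU by (simp add: U_def algebra_simps mult_scaleC_left mult_scaleC_right ii rs)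
  then have U: "(norm U)\<^sup>2 = \<bar>m\<bar>"
    by (simp add: norm_star_mult [symmetric] r(2) s(2))
  have "2 *\<^sub>R r = U + star U" unfolding sU by (simp add: U_def scaleR_2)
  then have "2 * norm r \<le> norm U + norm (star U)"
    by (metis abs_numeral norm_scaleR norm_triangle_ineq)
  then have "(norm r)\<^sup>2 \<le> (norm U)\<^sup>2" by (intro power_mono) auto
  then show ?thesis
    using U norm_self_adjoint_square [OF star(1)] by (simp add: r(2))
qed

text \<open>Adding the positive elements \<open>norm k - k\<close> and \<open>k - h\<close> shows
  that \<open>norm k - h\<close> is positive.\<close>

lemma norm_mono_positive:
  assumes "pos_elem h" "pos_elem (k - h)"
  shows "norm h \<le> norm k"
proof -
  have k: "pos_elem k" using positive_add [OF assms] by simp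
  have "pos_elem (norm k *\<^sub>R 1 - h)"
    using positive_add [OF positive_norm_minus [OF k] assms(2)] by simp
  then show ?thesis using norm_le_of_positive [OF assms(1)] by fastforce
qed

section \<open>Elements of the form \<open>star b * b\<close>\<close>

text \<open>Up to sign, \<open>x\<close> and \<open>y\<close> are twice the real and imaginary parts
  of \<open>c\<close>; the sum of their squares is twice the given element.\<close>

lemma positive_star_mult_plus_mult_star:
  "pos_elem (star c * c + c * star c)"
proof -
  define x where "x = c + star c"
  define y where "y = \<i> *\<^sub>C (c - star c)"
  have i: "\<i> *\<^sub>C \<i> *\<^sub>C z = - z" "(- \<i>) *\<^sub>C z = - (\<i> *\<^sub>C z)" for z :: 'a
    using complex_vector.scale_minus_left [of 1 z] complex_vector.scale_minus_left [of \<i> z]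
    by (simp_all add: scaleC_scaleC)
  have x: "star x = x" by (simp add: x_def star_add star_star add.commute)
  have y: "star y = y"
    by (simp add: y_def star_scaleC star_diff star_star i complex_vector.scale_right_diff_distrib)
  have "x * x + y * y = 2 *\<^sub>R (star c * c + c * star c)"
    by (simp add: x_def y_def mult_scaleC_left mult_scaleC_right i algebra_simps scaleR_2)
  then have "star c * c + c * star c = (1 / 2) *\<^sub>R (x * x + y * y)" by simp
  then show ?thesis
    using positive_scaleR [OF positive_add [OF positive_square [OF x] positive_square [OF y]], of "1 / 2"]
    by simp
qed

text \<open>Put \<open>n = norm (star c * c)\<close>. By the C*-identity and the hypothesis,
  \<open>norm (c * (n / 2 + star c * c) * star c) \<le> n\<^sup>2 / 2\<close>. On the other hand this element is
  \<open>n / 2 * P + P\<^sup>2\<close> with \<open>P = c * star c\<close> positive, so its norm is at least \<open>n\<^sup>2\<close>.\<close>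

lemma star_mult_negative_imp_zero:
  fixes c w :: "'a::{cstar_algebra,real_normed_algebra_1}"
  assumes w: "star w = w" and c: "star c * c = - (w * w)"
  shows "c = 0"
proof -
  define P where "P = c * star c"
  define n where "n = norm (w * w)"
  have n: "n = norm (star c * c)" by (simp add: n_def c)
  have nc: "n = norm c * norm c" by (simp add: n norm_star_mult power2_eq_square)
  have starP: "star P = P" by (simp add: P_def star_mult star_star)
  have nP: "norm P = n" by (simp add: P_def nc norm_mult_star power2_eq_square)
  \<comment> \<open>Positivity of \<open>P\<close> comes from the hypothesis: subtracting
    \<open>star c * c\<close> amounts to adding the square \<open>w * w\<close>.\<close>
  have "P = (star c * c + c * star c) + w * w" by (simp add: P_def c)
  then have P: "pos_elem P"
    using positive_add [OF positive_star_mult_plus_mult_star positive_square [OF w]] by metis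
  have "c * ((n / 2) *\<^sub>R 1 - w * w) * star c = (n / 2) *\<^sub>R P + P * P"
  proof -
    have "w * w = - (star c * c)" by (simp add: c)
    then show ?thesis by (simp add: P_def algebra_simps mult.assoc)
  qed
  then have "norm ((n / 2) *\<^sub>R P + P * P) \<le> norm (c * ((n / 2) *\<^sub>R 1 - w * w)) * norm (star c)"
    by (metis norm_mult_ineq)
  also have "\<dots> \<le> norm c * norm ((n / 2) *\<^sub>R 1 - w * w) * norm (star c)"
    by (intro mult_right_mono norm_mult_ineq) simp
  also have "\<dots> \<le> norm c * (n / 2) * norm (star c)"
    unfolding n_def by (intro mult_right_mono mult_left_mono norm_half_minus_square_le w) auto
  also have "\<dots> = n * n / 2" by (simp add: nc)
  finally have up: "norm ((n / 2) *\<^sub>R P + P * P) \<le> n * n / 2" .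
  \<comment> \<open>The difference of the two elements is the positive
    \<open>(n / 2) *\<^sub>R P\<close>, so monotonicity of the norm applies.\<close>
  have "norm (P * P) \<le> norm ((n / 2) *\<^sub>R P + P * P)"
    by (intro norm_mono_positive positive_square starP)
      (simp add: positive_scaleR P n_def)
  then have "n * n \<le> n * n / 2"
    using up by (simp add: norm_self_adjoint_square starP nP power2_eq_square)
  then have "n * n \<le> 0" by linarith
  then have "n = 0" using mult_nonneg_nonneg [of n n] by (simp add: mult_le_0_iff n_def)
  then show ?thesis using nc by simp
qed

text \<open>Let \<open>h = star b * b\<close> and \<open>k = |h| - h\<close>. Then \<open>c = b * k\<close> satisfies
  \<open>star c * c = k h k = - k |h| k\<close>, so \<open>c = 0\<close> and hence \<open>k = 0\<close>.\<close>

theorem positive_star_mult: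
  fixes b :: "'a::{cstar_algebra,real_normed_algebra_1}"
  shows "pos_elem (star b * b)"
proof -
  define h where "h = star b * b"
  have h: "star h = h" by (simp add: h_def star_mult star_star)
  \<comment> \<open>Here \<open>q\<close> is the absolute value of \<open>h\<close>. Its root
    \<open>r\<close> serves to write \<open>k * q * k\<close> as the square of
    \<open>w = k * r\<close>.\<close>
  obtain q where q: "pos_elem q" "q * q = h * h"
    and comm_q: "\<And>x. x * (h * h) = h * h * x \<Longrightarrow> x * q = q * x"
    using positive_sqrt [OF positive_square [OF h]] by metis
  obtain r where r: "pos_elem r" "r * r = q" and comm_r: "\<And>x. x * q = q * x \<Longrightarrow> x * r = r * x"
    using positive_sqrt [OF q(1)] by metis
  have hq: "h * q = q * h" by (rule comm_q) (simp add: mult.assoc)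
  define k where "k = q - h"
  have k: "star k = k" by (simp add: k_def star_diff h positive_star [OF q(1)])
  have kr: "k * r = r * k"
    by (rule comm_r) (simp add: k_def algebra_simps hq)
  define w where "w = k * r"
  have w: "star w = w" using kr by (simp add: w_def star_mult k positive_star [OF r(1)])
  \<comment> \<open>As \<open>h\<close> and \<open>q\<close> commute and have equal squares,
    \<open>(q + h) * (q - h) = 0\<close>.\<close>
  have hk: "h * k = - (q * k)" by (simp add: k_def algebra_simps hq q(2))
  have "star (b * k) * (b * k) = k * (h * k)" by (simp add: star_mult k h_def mult.assoc)
  also have "\<dots> = - (k * r * (r * k))" by (simp add: hk r(2) [symmetric] mult.assoc)
  also have "\<dots> = - (w * w)" by (simp add: w_def kr)
  finally have c: "star (b * k) * (b * k) = - (w * w)" .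
  have "b * k = 0" by (rule star_mult_negative_imp_zero [OF w c])
  then have "w * w = 0" using c by simp
  then have "w = 0" using norm_self_adjoint_square [OF w] by simp
  then have "q * k = 0" by (metis kr mult.assoc mult_zero_right r(2) w_def)
  moreover have "k * k = q * k - h * k" by (simp add: k_def left_diff_distrib)
  ultimately have "k * k = 0" by (simp add: hk)
  then have "k = 0" using norm_self_adjoint_square [OF k] by simp
  then show ?thesis using q(1) by (simp add: k_def h_def)
qed

text \<open>The algebra itself may have no unit, so its cone is the one induced from the
  unitization.\<close>

definition nonneg :: "'a::cstar_algebra \<Rightarrow> bool" where
  "nonneg a \<longleftrightarrow> pos_elem (embed a)"

lemma nonneg_star_mult: "nonneg (star b * b)"
  unfolding nonneg_def embed_simps by (rule positive_star_mult)

lemma nonneg_add: "nonneg a \<Longrightarrow> nonneg b \<Longrightarrow> nonneg (a + b)"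
  unfolding nonneg_def embed_simps by (rule positive_add)

lemma nonneg_scaleR: "nonneg a \<Longrightarrow> 0 \<le> r \<Longrightarrow> nonneg (r *\<^sub>R a)"
  unfolding nonneg_def embed_simps by (rule positive_scaleR)

lemma nonneg_norm_mono: "nonneg a \<Longrightarrow> nonneg (b - a) \<Longrightarrow> norm a \<le> norm b"
  using norm_mono_positive unfolding nonneg_def embed_simps by (fastforce simp: norm_embed)

text \<open>In the unitization \<open>norm h - h\<close> is a square \<open>s * s\<close> with
  \<open>s\<close> self-adjoint, so the element has the form \<open>star v * v\<close> with
  \<open>v = s * w\<close>.\<close>

lemma nonneg_norm_conjugate:
  assumes "nonneg h"
  shows "nonneg (norm h *\<^sub>R (star w * w) - star w * h * w)"
proof -
  let ?h = "embed h" and ?w = "embed w"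
  obtain s where s: "pos_elem s" "s * s = norm h *\<^sub>R 1 - ?h"
    using positive_sqrt [OF positive_norm_minus, of ?h] assms
    unfolding nonneg_def norm_embed by metis
  have "star (s * ?w) * (s * ?w) = star ?w * (s * s) * ?w"
    by (simp add: star_mult positive_star [OF s(1)] mult.assoc)
  also have "\<dots> = embed (norm h *\<^sub>R (star w * w) - star w * h * w)"
    by (simp add: s(2) embed_simps algebra_simps)
  finally show ?thesis unfolding nonneg_def by (metis positive_star_mult)
qed

section \<open>The module seminorm\<close>

context semi_inner_product_module
begin

lemma ip_zero_right [simp]: "ip x 0 = 0"
  using ip_add [of x 0 0] by simp

lemma ip_minus_right: "ip x (- y) = - ip x y"
  using ip_add [of x y "- y"] by (simp add: add_eq_0_iff)

lemma ip_diff_right: "ip x (y - z) = ip x y - ip x z"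
  using ip_add [of x y "- z"] by (simp add: ip_minus_right)

lemma ip_add_left: "ip (x + y) z = ip x z + ip y z"
  by (metis ip_add ip_star star_add)

lemma ip_diff_left: "ip (x - y) z = ip x z - ip y z"
  by (metis ip_diff_right ip_star star_diff)

text \<open>Without a unit in the algebra, homogeneity is first obtained after multiplication by an
  arbitrary element.\<close>

lemma ip_scaleC_right: "ip x (c *\<^sub>C y) = c *\<^sub>C ip x y"
proof -
  let ?d = "ip x (c *\<^sub>C y) - c *\<^sub>C ip x y"
  have "?d * a = 0" for a
  proof -
    have "ip x (c *\<^sub>C y) * a = ip x (act y (c *\<^sub>C a))"
      by (simp add: ip_act [symmetric] act_scaleC_left act_scaleC_right)
    also have "\<dots> = c *\<^sub>C ip x y * a"
      by (simp add: ip_act mult_scaleC_left mult_scaleC_right)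
    finally show ?thesis by (simp add: left_diff_distrib)
  qed
  then have "norm (?d * star ?d) = 0" by simp
  then have "norm ?d = 0" unfolding norm_mult_star by simp
  then show ?thesis by simp
qed

lemma ip_scaleC_left: "ip (c *\<^sub>C x) y = cnj c *\<^sub>C ip x y"
  by (metis ip_scaleC_right ip_star star_scaleC)

lemma ip_scaleR_right: "ip x (r *\<^sub>R y) = r *\<^sub>R ip x y"
  by (metis ip_scaleC_right scaleC_of_real)

lemma ip_scaleR_left: "ip (r *\<^sub>R x) y = r *\<^sub>R ip x y"
  by (metis ip_scaleR_right ip_star star_scaleR)

lemma ip_act_left: "ip (act x a) y = star a * ip x y"
  by (metis ip_act ip_star star_mult)

lemma nonneg_ip: "nonneg (ip x x)"
  using ip_nonneg [of x] nonneg_star_mult by (auto simp: cstar_nonneg_def)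

text \<open>Expand \<open>ip z z\<close> for \<open>z = y - m\<^sup>-\<^sup>1 x \<langle>x, y\<rangle>\<close>.\<close>

lemma norm_ip_square_le_aux:
  assumes "norm (ip x x) \<le> m" "0 < m"
  shows "(norm (ip x y))\<^sup>2 \<le> m * norm (ip y y)"
proof -
  define w where "w = ip x y"
  define t where "t = inverse m"
  have w': "ip y x = star w" by (simp add: w_def ip_star)
  define z where "z = y - t *\<^sub>R act x w"
  let ?h = "ip x x"
  have "ip z z = ip y y - t *\<^sub>R (star w * w) - t *\<^sub>R (star w * w) + (t * t) *\<^sub>R (star w * ?h * w)"
    by (simp add: z_def ip_diff_left ip_diff_right ip_scaleR_left ip_scaleR_right ip_act ip_act_left
        w' w_def [symmetric] algebra_simps)
  moreover have tm: "t * t * (m - norm ?h) = t - t * t * norm ?h"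
    using assms(2) by (simp add: t_def field_simps)
  \<comment> \<open>All three summands lie in the cone, the last one because \<open>m\<close> is at
    least \<open>norm ?h\<close>.\<close>
  ultimately have "ip y y - t *\<^sub>R (star w * w)
      = ip z z + (t * t) *\<^sub>R (norm ?h *\<^sub>R (star w * w) - star w * ?h * w)
        + (t * t * (m - norm ?h)) *\<^sub>R (star w * w)"
    by (simp only: tm) (simp add: algebra_simps)
  moreover have "nonneg \<dots>"
    using assms by (intro nonneg_add nonneg_ip nonneg_scaleR nonneg_norm_conjugate nonneg_star_mult) auto
  ultimately have "nonneg (ip y y - t *\<^sub>R (star w * w))" by simp
  then have "norm (t *\<^sub>R (star w * w)) \<le> norm (ip y y)"
    by (rule nonneg_norm_mono [rotated]) (use assms in \<open>simp add: nonneg_scaleR nonneg_star_mult t_def\<close>)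
  then have "t * (norm w)\<^sup>2 \<le> norm (ip y y)"
    using assms(2) by (simp add: norm_star_mult t_def)
  then show ?thesis using assms(2) by (simp add: t_def w_def field_simps)
qed

abbreviation N :: "'x \<Rightarrow> real" where "N \<equiv> ip_norm ip"

lemma N_nonneg [simp]: "0 \<le> N x"
  by (simp add: ip_norm_def)

lemma N_square: "(N x)\<^sup>2 = norm (ip x x)"
  by (simp add: ip_norm_def)

text \<open>The auxiliary bound needs a positive \<open>m\<close>, whereas
  \<open>norm (ip x x)\<close> may vanish; so take \<open>m = norm (ip x x) + e\<close> and let
  \<open>e\<close> tend to \<open>0\<close>.\<close>

theorem Cauchy_Schwarz: "norm (ip x y) \<le> N x * N y"
proof (rule power2_le_imp_le)
  have "((\<lambda>e. (norm (ip x x) + e) * norm (ip y y)) \<longlongrightarrow> (norm (ip x x) + 0) * norm (ip y y)) (at_right 0)"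
    by (intro tendsto_intros)
  moreover have "\<forall>\<^sub>F e in at_right 0. (norm (ip x y))\<^sup>2 \<le> (norm (ip x x) + e) * norm (ip y y)"
    using eventually_at_right_less
  proof (rule eventually_mono)
    fix e :: real assume "0 < e"
    then show "(norm (ip x y))\<^sup>2 \<le> (norm (ip x x) + e) * norm (ip y y)"
      by (intro norm_ip_square_le_aux) (auto intro: add_nonneg_pos)
  qed
  ultimately have "(norm (ip x y))\<^sup>2 \<le> (norm (ip x x) + 0) * norm (ip y y)"
    by (intro tendsto_lowerbound) auto
  then show "(norm (ip x y))\<^sup>2 \<le> (N x * N y)\<^sup>2"
    by (simp add: power_mult_distrib N_square)
qed simp

lemma N_triangle: "N (x + y) \<le> N x + N y"
proof (rule power2_le_imp_le)
  have "(N (x + y))\<^sup>2 = norm (ip x x + ip x y + (ip y x + ip y y))"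
    by (simp add: N_square ip_add ip_add_left add_ac)
  also have "\<dots> \<le> N x * N x + N x * N y + (N y * N x + N y * N y)"
    by (intro norm_triangle_mono Cauchy_Schwarz)
  finally show "(N (x + y))\<^sup>2 \<le> (N x + N y)\<^sup>2"
    by (simp add: power2_eq_square algebra_simps)
qed simp

lemma N_diff: "N (x - y) \<le> N x + N y"
proof -
  have "N (- y) = N y" using ip_scaleR_left [of "-1" y] by (simp add: ip_norm_def ip_minus_right)
  then show ?thesis using N_triangle [of x "- y"] by simp
qed

end

section \<open>The reduced inner product\<close>

lemma ip_has_derivativeD:
  assumes "ip_has_derivative ip f u q"
  shows "u (a + b) = u a + u b" "u (r *\<^sub>R a) = r *\<^sub>R u a"
    "\<exists>K. \<forall>h. ip_norm ip (u h) \<le> K * norm h"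
    "((\<lambda>h. ip_norm ip (f (q + h) - f q - u h) / norm h) \<longlongrightarrow> 0) (at 0)"
proof -
  have lin: "Vector_Spaces.linear (*\<^sub>C) (*\<^sub>C) u"
    using assms by (simp add: ip_has_derivative_def)
  show "u (a + b) = u a + u b" "u (r *\<^sub>R a) = r *\<^sub>R u a"
    using Vector_Spaces.linear.axioms(3) [OF lin]
    by (simp_all add: module_hom_axioms_def scaleC_of_real [symmetric] module_hom.add module_hom.scale)
qed (use assms in \<open>simp_all add: ip_has_derivative_def\<close>)

locale idempotent_frame = semi_inner_product_module act ip
  for act :: "'x::complex_vector \<Rightarrow> 'a::cstar_algebra \<Rightarrow> 'x" and ip +
  fixes e :: 'x
  assumes idempotent: "ip e e * ip e e = ip e e"
begin

abbreviation ip1e :: "'x \<Rightarrow> 'x \<Rightarrow> 'a" where "ip1e \<equiv> ip1 ip e"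

text \<open>A self-adjoint idempotent has norm equal to its own square, by the C*-identity.\<close>

lemma N_e_le_1: "N e \<le> 1"
proof -
  have "norm (ip e e) = (norm (ip e e))\<^sup>2"
    using norm_star_mult [of "ip e e"] by (simp add: ip_star idempotent)
  then have "norm (ip e e) \<le> 1"
    by (metis linorder_not_less mult_cancel_right1 norm_le_zero_iff norm_zero order.refl power2_eq_square zero_le_one)
  then show ?thesis by (simp add: ip_norm_def)
qed

text \<open>Idempotency cancels all terms of \<open>ip ?v ?v\<close>, and Cauchy-Schwarz then makes
  \<open>?v\<close> orthogonal to every \<open>y\<close>.\<close>

lemma idempotent_mult_ip: "ip e e * ip e y = ip e y"
proof -
  let ?v = "e - act e (ip e e)"
  have "ip ?v ?v = 0"
    by (simp add: ip_diff_left ip_diff_right ip_act ip_act_left ip_star idempotent mult.assoc)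
  then have "N ?v = 0" by (simp add: ip_norm_def)
  then have "ip ?v y = 0" using Cauchy_Schwarz [of ?v y] by simp
  then show ?thesis by (simp add: ip_diff_left ip_act_left ip_star)
qed

lemma ip_mult_idempotent: "ip x e * ip e e = ip x e"
  by (metis idempotent_mult_ip ip_star star_mult)

lemma ip1_add_left: "ip1e (x + y) z = ip1e x z + ip1e y z"
  by (simp add: ip1_def ip_add_left algebra_simps)

lemma ip1_add_right: "ip1e x (y + z) = ip1e x y + ip1e x z"
  by (simp add: ip1_def ip_add algebra_simps)

lemma ip1_diff_left: "ip1e (x - y) z = ip1e x z - ip1e y z"
  by (simp add: ip1_def ip_diff_left algebra_simps)

lemma ip1_diff_right: "ip1e x (y - z) = ip1e x y - ip1e x z"
  by (simp add: ip1_def ip_diff_right algebra_simps)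

lemma ip1_scaleR_left: "ip1e (r *\<^sub>R x) y = r *\<^sub>R ip1e x y"
  by (simp add: ip1_def ip_scaleR_left scaleR_diff_right)

lemma ip1_scaleR_right: "ip1e x (r *\<^sub>R y) = r *\<^sub>R ip1e x y"
  by (simp add: ip1_def ip_scaleR_right scaleR_diff_right)

lemma ip1_scaleC_e_left: "ip1e (c *\<^sub>C e) y = 0"
  by (simp add: ip1_def ip_scaleC_left mult_scaleC_left idempotent_mult_ip)

lemma ip1_scaleC_e_right: "ip1e x (c *\<^sub>C e) = 0"
  by (simp add: ip1_def ip_scaleC_right mult_scaleC_right ip_mult_idempotent)

text \<open>The optimal constant is 1, but the factor 2 is affordable.\<close>

lemma norm_ip1_le: "norm (ip1e x y) \<le> 2 * (N x * N y)"
proof -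
  have "norm (ip x e * ip e y) \<le> norm (ip x e) * norm (ip e y)"
    by (rule norm_mult_ineq)
  also have "\<dots> \<le> (N x * N e) * (N e * N y)"
    by (intro mult_mono Cauchy_Schwarz) auto
  also have "\<dots> = (N e * N e) * (N x * N y)" by simp
  also have "\<dots> \<le> 1 * (N x * N y)"
    using N_e_le_1 by (intro mult_right_mono) (auto intro: mult_le_one)
  finally show ?thesis
    using Cauchy_Schwarz [of x y] norm_triangle_ineq4 [of "ip x y" "ip x e * ip e y"]
    by (simp add: ip1_def)
qed

text \<open>The usual product rule for a bounded sesquilinear map, carried out with the seminorm
  \<open>N\<close>; \<open>norm_ip1_le\<close> supplies the boundedness.\<close>

lemma ip1_has_derivative:
  assumes u: "ip_has_derivative ip f u p" and v: "ip_has_derivative ip g v p"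
  shows "((\<lambda>t. ip1e (f t) (g t)) has_derivative (\<lambda>h. ip1e (u h) (g p) + ip1e (f p) (v h))) (at p)"
    (is "(?F has_derivative ?D) _")
proof -
  obtain K where K: "N (u h) \<le> K * norm h" for h using ip_has_derivativeD(3) [OF u] by blast
  obtain L where L: "N (v h) \<le> L * norm h" for h using ip_has_derivativeD(3) [OF v] by blast
  define r where "r h = f (p + h) - f p - u h" for h
  define s where "s h = g (p + h) - g p - v h" for h
  have r: "((\<lambda>h. N (r h) / norm h) \<longlongrightarrow> 0) (at 0)" and s: "((\<lambda>h. N (s h) / norm h) \<longlongrightarrow> 0) (at 0)"
    using ip_has_derivativeD(4) [OF u] ip_has_derivativeD(4) [OF v] by (simp_all add: r_def s_def)
  have "bounded_linear ?D"
  proof (rule bounded_linear_intro)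
    show "norm (?D h) \<le> norm h * (2 * K * N (g p) + 2 * N (f p) * L)" for h
    proof -
      have "norm (?D h) \<le> 2 * (N (u h) * N (g p)) + 2 * (N (f p) * N (v h))"
        by (intro norm_triangle_mono norm_ip1_le)
      also have "\<dots> \<le> 2 * (K * norm h * N (g p)) + 2 * (N (f p) * (L * norm h))"
        by (intro add_mono mult_left_mono mult_right_mono K L) auto
      finally show ?thesis by (simp add: algebra_simps)
    qed
  qed (simp_all add: ip_has_derivativeD(1,2) [OF u] ip_has_derivativeD(1,2) [OF v] ip1_add_left
      ip1_add_right ip1_scaleR_left ip1_scaleR_right scaleR_add_right)
  moreover have "((\<lambda>h. norm (?F (p + h) - ?F p - ?D h) / norm h) \<longlongrightarrow> 0) (at 0)"
  proof (rule tendsto_sandwich [OF _ _ tendsto_const])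
    \<comment> \<open>The summands of \<open>?b\<close> belong to the three terms of the remainder
      below, divided by \<open>norm h\<close>. Writing \<open>N (s h)\<close> as a quotient times
      \<open>norm h\<close> lets the limit be read off.\<close>
    let ?b = "\<lambda>h. 2 * (N (r h) / norm h * (N (g p) + L * norm h + N (s h) / norm h * norm h))
      + 2 * ((N (f p) + K * norm h) * (N (s h) / norm h)) + 2 * (K * norm h * L)"
    have "(?b \<longlongrightarrow> 2 * (0 * (N (g p) + L * norm (0::'a) + 0 * norm (0::'a)))
        + 2 * ((N (f p) + K * norm (0::'a)) * 0) + 2 * (K * norm (0::'a) * L)) (at 0)"
      by (intro tendsto_intros r s)
    then show "(?b \<longlongrightarrow> 0) (at 0)" by simp
    have "norm (?F (p + h) - ?F p - ?D h) / norm h \<le> ?b h" if h: "h \<noteq> 0" for h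
    proof -
      have fg: "f (p + h) = f p + u h + r h" "g (p + h) = g p + v h + s h"
        by (simp_all add: r_def s_def)
      have "?F (p + h) - ?F p - ?D h
          = ip1e (r h) (g p + v h + s h) + ip1e (f p + u h) (s h) + ip1e (u h) (v h)"
        unfolding fg by (simp add: ip1_add_left ip1_add_right)
      then have "norm (?F (p + h) - ?F p - ?D h)
          \<le> 2 * (N (r h) * N (g p + v h + s h)) + 2 * (N (f p + u h) * N (s h)) + 2 * (N (u h) * N (v h))"
        by (simp only:) (intro norm_triangle_mono norm_ip1_le)
      \<comment> \<open>The sign of \<open>K\<close> is not given, but \<open>K * norm h\<close> is
        nonnegative since it bounds \<open>N (u h)\<close>.\<close>
      also have "\<dots> \<le> 2 * (N (r h) * (N (g p) + L * norm h + N (s h)))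
          + 2 * ((N (f p) + K * norm h) * N (s h)) + 2 * ((K * norm h) * (L * norm h))"
        using N_triangle [of "g p + v h" "s h"] N_triangle [of "g p" "v h"] N_triangle [of "f p" "u h"]
          K [of h] L [of h] order_trans [OF N_nonneg K [of h]]
        by (intro add_mono mult_left_mono mult_mono) auto
      also have "\<dots> = ?b h * norm h" using h by (simp add: field_simps)
      finally show ?thesis using h by (simp add: divide_le_eq)
    qed
    then show "\<forall>\<^sub>F h in at 0. norm (?F (p + h) - ?F p - ?D h) / norm h \<le> ?b h"
      by (simp add: eventually_at_filter)
  qed simp
  ultimately show ?thesis by (simp add: has_derivative_at)
qed

end

theorem lemma1:
  fixes act :: "'x::complex_vector \<Rightarrow> 'a::cstar_algebra \<Rightarrow> 'x"
    and ip :: "'x \<Rightarrow> 'x \<Rightarrow> 'a"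
    and p a :: 'a and e :: 'x
    and f g Dfp Dgp :: "'a \<Rightarrow> 'x"
    and \<alpha> \<beta> \<alpha>' \<beta>' \<mu> lam \<mu>' lam' :: complex
  assumes "semi_inner_product_module act ip"
    and "ip e e * ip e e = ip e e"
    and "f \<in> differentiable_near ip p" and "g \<in> differentiable_near ip p"
    and "ip_has_derivative ip f Dfp p" and "ip_has_derivative ip g Dgp p"
    and "ip_norm ip (f p - ((\<alpha> + \<beta>) / 2) *\<^sub>C e) \<le> 1 / 2 * cmod (\<alpha> - \<beta>)"
    and "ip_norm ip (Dfp a - ((\<alpha>' + \<beta>') / 2) *\<^sub>C e) \<le> 1 / 2 * cmod (\<alpha>' - \<beta>')"
    and "ip_norm ip (g p - ((lam + \<mu>) / 2) *\<^sub>C e) \<le> 1 / 2 * cmod (lam - \<mu>)"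
    and "ip_norm ip (Dgp a - ((\<mu>' + lam') / 2) *\<^sub>C e) \<le> 1 / 2 * cmod (\<mu>' - lam')"
  shows "norm (ip1 ip e (Dfp a) (Dgp a) + ip1 ip e (f p) (g p)
             - frechet_derivative (\<lambda>t. ip1 ip e (f t) (g t)) (at p) a)
         \<le> 1 / 2 * (cmod (\<alpha> - \<beta>) + cmod (\<alpha>' - \<beta>')) * (cmod (lam - \<mu>) + cmod (lam' - \<mu>'))"
proof -
  interpret idempotent_frame act ip e
    using assms(1,2) by (simp add: idempotent_frame_def idempotent_frame_axioms_def)
  \<comment> \<open>These are \<open>Dfp a - f p\<close> and \<open>Dgp a - g p\<close> up to
    multiples of \<open>e\<close>, which \<open>ip1e\<close> does not see. The cross terms of their
    product form the derivative.\<close>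
  let ?x = "Dfp a - ((\<alpha>' + \<beta>') / 2) *\<^sub>C e - (f p - ((\<alpha> + \<beta>) / 2) *\<^sub>C e)"
  let ?y = "Dgp a - ((\<mu>' + lam') / 2) *\<^sub>C e - (g p - ((lam + \<mu>) / 2) *\<^sub>C e)"
  have "frechet_derivative (\<lambda>t. ip1e (f t) (g t)) (at p) a = ip1e (Dfp a) (g p) + ip1e (f p) (Dgp a)"
    using frechet_derivative_at [OF ip1_has_derivative [OF assms(5,6)]] by metis
  then have "ip1e (Dfp a) (Dgp a) + ip1e (f p) (g p) - frechet_derivative (\<lambda>t. ip1e (f t) (g t)) (at p) a
      = ip1e ?x ?y"
    by (simp add: ip1_diff_left ip1_diff_right ip1_scaleC_e_left ip1_scaleC_e_right)
  also have "norm \<dots> \<le> 2 * (N ?x * N ?y)" by (rule norm_ip1_le)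
  \<comment> \<open>Each half comes from a radius in the hypotheses; with the factor 2 of
    \<open>norm_ip1_le\<close> they leave exactly \<open>1 / 2\<close>.\<close>
  also have "\<dots> \<le> 2 * ((1 / 2 * (cmod (\<alpha> - \<beta>) + cmod (\<alpha>' - \<beta>')))
      * (1 / 2 * (cmod (lam - \<mu>) + cmod (lam' - \<mu>'))))"
  proof (intro mult_left_mono mult_mono)
    show "N ?x \<le> 1 / 2 * (cmod (\<alpha> - \<beta>) + cmod (\<alpha>' - \<beta>'))"
      by (rule order_trans [OF N_diff]) (use assms(7,8) in simp)
    show "N ?y \<le> 1 / 2 * (cmod (lam - \<mu>) + cmod (lam' - \<mu>'))"
      by (rule order_trans [OF N_diff]) (use assms(9,10) in \<open>simp add: norm_minus_commute [of \<mu>' lam']\<close>)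
  qed auto
  finally show ?thesis by simp
qed

end
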